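(* Let $(X,\mu,S)$ be a finitely generated multiplicative system. Then $\overline{\mathcal{H}_1}=L^2(X,\sigma(\mathcal{I}_{\mathrm{pr}}),\mu)$.
   Context: $\mathbb{N}=\{1,2,\dots\}$ and $\mathbb{P}$ is the set of primes. Every probability space $(X,\mu)$ is assumed regular: $X$ is a compact metric space with its Borel $\sigma$-algebra. A multiplicative system $(X,\mu,S)$ consists of a probability space $(X,\mu)$ and a sequence $S=(S_n)_{n\in\mathbb{N}}$ of commuting invertible measure-preserving transformations of $(X,\mu)$ with $S_{nm}=S_n\circ S_m$ for all $n,m\in\mathbb{N}$. It is finitely generated if $\{S_p:p\in\mathbb{P}\}$ is finite. For $F\in L^2(X)$, $S_nF=F\circ S_n$. $\mathcal{H}_1=\{F\in L^2(X):\frac12\sum_{p\in\mathbb{P}}\frac{\|S_pF-F\|_2^2}{p}<\infty\}$, and $\overline{\mathcal{H}_1}$ is its closure in $L^2(X)$. $\mathcal{I}_{\mathrm{pr}}$ is the collection of measurable sets $A\subseteq X$ with $\mathbf{1}_A\in\mathcal{H}_1$, and $\sigma(\mathcal{I}_{\mathrm{pr}})$ is the $\sigma$-algebra generated by $\mathcal{I}_{\mathrm{pr}}$. $L^2(X,\sigma(\mathcal{I}_{\mathrm{pr}}),\mu)$ is viewed as a subspace of $L^2(X)$ in the usual way. *)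

theory Defs
  imports "HOL-Probability.Probability" "HOL-Computational_Algebra.Primes"
begin

text \<open>
  The compact metric space is the set \<open>space M\<close>, with the metric of the ambient type;
  it may be the whole type.
\<close>

locale regular_prob_space = prob_space M for M :: "'a::metric_space measure" +
  assumes compact_space: "compact (space M)"
    and borel_sets: "sets M = sets (restrict_space borel (space M))"

text \<open>
  The natural numbers of the theory start at 1, so nothing is required of \<open>S 0\<close>, nor of the values
  of \<open>S n\<close> outside \<open>space M\<close>.
\<close>

locale multiplicative_system = regular_prob_space M for M :: "'a::metric_space measure" +
  fixes S :: "nat \<Rightarrow> 'a \<Rightarrow> 'a"
  assumes measurable: "\<And>n. n \<ge> 1 \<Longrightarrow> S n \<in> M \<rightarrow>\<^sub>M M"
    and bij: "\<And>n. n \<ge> 1 \<Longrightarrow> bij_betw (S n) (space M) (space M)"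
    and measurable_inv: "\<And>n. n \<ge> 1 \<Longrightarrow> inv_into (space M) (S n) \<in> M \<rightarrow>\<^sub>M M"
    and measure_preserving: "\<And>n. n \<ge> 1 \<Longrightarrow> distr M M (S n) = M"
    and commute: "\<And>n m x. n \<ge> 1 \<Longrightarrow> m \<ge> 1 \<Longrightarrow> x \<in> space M \<Longrightarrow> S n (S m x) = S m (S n x)"
    and mult: "\<And>n m x. n \<ge> 1 \<Longrightarrow> m \<ge> 1 \<Longrightarrow> x \<in> space M \<Longrightarrow> S (n * m) x = S n (S m x)"

text \<open>Restricting to \<open>space M\<close> identifies maps that agree on the space.\<close>

definition finitely_generated :: "'a measure \<Rightarrow> (nat \<Rightarrow> 'a \<Rightarrow> 'a) \<Rightarrow> bool" where
  "finitely_generated M S \<longleftrightarrow> finite {restrict (S p) (space M) | p. prime p}"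

text \<open>
  Elements of \<open>L\<^sup>2\<close> are represented by square-integrable functions. A subset of \<open>L\<^sup>2\<close> is represented
  by the set of all representatives of its members; all subsets defined below are closed under
  almost everywhere equality of measurable functions, so equality of subsets of \<open>L\<^sup>2\<close> is equality of these sets.
\<close>

definition L2 :: "'a measure \<Rightarrow> ('a \<Rightarrow> complex) set" where
  "L2 M = {F \<in> borel_measurable M. integrable M (\<lambda>x. (cmod (F x))\<^sup>2)}"

definition L2_norm :: "'a measure \<Rightarrow> ('a \<Rightarrow> complex) \<Rightarrow> real" where
  "L2_norm M F = sqrt (\<integral>x. (cmod (F x))\<^sup>2 \<partial>M)"

definition L2_closure :: "'a measure \<Rightarrow> ('a \<Rightarrow> complex) set \<Rightarrow> ('a \<Rightarrow> complex) set" where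
  "L2_closure M H = {F \<in> L2 M. \<forall>\<epsilon>>0. \<exists>G\<in>H. L2_norm M (\<lambda>x. F x - G x) < \<epsilon>}"

text \<open>
  \<open>L\<^sup>2\<close> of a sub-\<open>\<sigma>\<close>-algebra \<open>sets N\<close> of \<open>sets M\<close>, as a subspace of \<open>L2 M\<close>: the classes having an
  \<open>N\<close>-measurable representative. The measure of \<open>N\<close> is irrelevant.
\<close>

definition L2_subalg :: "'a measure \<Rightarrow> 'a measure \<Rightarrow> ('a \<Rightarrow> complex) set" where
  "L2_subalg M N = {F \<in> L2 M. \<exists>G \<in> L2 (restr_to_subalg M N). AE x in M. F x = G x}"

text \<open>The sum over the primes is taken in \<open>[0, \<infinity>]\<close>, where it always exists.\<close>

definition H1 :: "'a measure \<Rightarrow> (nat \<Rightarrow> 'a \<Rightarrow> 'a) \<Rightarrow> ('a \<Rightarrow> complex) set" where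
  "H1 M S = {F \<in> L2 M.
     1 / 2 * (\<Sum>\<^sub>\<infinity>p\<in>{p. prime p}. ennreal ((L2_norm M (\<lambda>x. F (S p x) - F x))\<^sup>2 / real p)) < \<infinity>}"

definition I_pr :: "'a measure \<Rightarrow> (nat \<Rightarrow> 'a \<Rightarrow> 'a) \<Rightarrow> 'a set set" where
  "I_pr M S = {A \<in> sets M. indicator A \<in> H1 M S}"

end

theory Submission
  imports Defs
begin

text \<open>
  Group the primes by the transformation they induce. As there are only finitely many groups, the
  sum defining \<open>\<H>\<^sub>1\<close> is finite iff \<open>F\<close> is almost everywhere invariant under every transformation
  whose group has a divergent sum of reciprocals. Hence \<open>\<H>\<^sub>1\<close> is the set of functions
  invariant under a family of measure-preserving maps: it is closed, the sets with indicator in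
  \<open>\<H>\<^sub>1\<close> already form a \<open>\<sigma>\<close>-algebra, and invariance of a function is the same as
  measurability with respect to that \<open>\<sigma>\<close>-algebra.
\<close>

section \<open>Infinite sums with values in \<open>[0, \<infinity>]\<close>\<close>

lemma infsum_UN_finite_ennreal:
  fixes f :: "'b \<Rightarrow> ennreal"
  assumes "finite I" and "\<And>i. i \<in> I \<Longrightarrow> infsum f (A i) < \<infinity>"
  shows "infsum f (\<Union>i\<in>I. A i) < \<infinity>"
  using assms
proof (induction I rule: finite_induct)
  case empty
  then show ?case by simp
next
  case (insert i I)
  let ?U = "\<Union>i\<in>I. A i"
  have "infsum f (?U - A i) \<le> infsum f ?U"
    by (rule infsum_mono_neutral) (auto intro: nonneg_summable_on_complete)
  also have "\<dots> < \<infinity>"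
    by (rule insert.IH) (rule insert.prems, simp)
  finally have "infsum f (A i) + infsum f (?U - A i) < \<infinity>"
    using insert.prems[of i] by simp
  also have "infsum f (A i) + infsum f (?U - A i) = infsum f (A i \<union> (?U - A i))"
    by (rule infsum_Un_disjoint[symmetric]) (auto intro: nonneg_summable_on_complete)
  also have "A i \<union> (?U - A i) = (\<Union>i\<in>insert i I. A i)"
    by auto
  finally show ?case .
qed

text \<open>Multiplication by a finite constant is additive and continuous on all of
  \<open>[0, \<infinity>]\<close>, so it commutes with the limit of the finite partial sums, even
  when that limit is infinite.\<close>

lemma infsum_cmult_ennreal:
  fixes g :: "'b \<Rightarrow> ennreal"
  assumes "c < \<infinity>"
  shows "(\<Sum>\<^sub>\<infinity>x\<in>A. c * g x) = c * infsum g A"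
proof -
  have "isCont ((*) c) (infsum g A)"
    unfolding isCont_def
    by (rule ennreal_tendsto_cmult[OF _ tendsto_ident_at]) (use assms in simp)
  then have "infsum ((*) c \<circ> g) A = c * infsum g A"
    by (intro infsum_comm_additive_general) (simp_all add: sum_distrib_left nonneg_summable_on_complete)
  then show ?thesis by (simp add: comp_def)
qed

section \<open>Square-integrable functions and measure-preserving maps\<close>

lemma cmod_add_squared_le: "(cmod (a + b))\<^sup>2 \<le> 2 * (cmod a)\<^sup>2 + 2 * (cmod b)\<^sup>2"
proof -
  have "(cmod (a + b))\<^sup>2 \<le> (cmod a + cmod b)\<^sup>2"
    by (simp add: norm_triangle_ineq power_mono)
  also have "\<dots> \<le> 2 * (cmod a)\<^sup>2 + 2 * (cmod b)\<^sup>2"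
    using sum_squares_bound[of "cmod a" "cmod b"] by (simp add: power2_sum)
  finally show ?thesis .
qed

lemma L2_measurable: "F \<in> L2 M \<Longrightarrow> F \<in> borel_measurable M"
  by (simp add: L2_def)

lemma L2_integrable: "F \<in> L2 M \<Longrightarrow> integrable M (\<lambda>x. (cmod (F x))\<^sup>2)"
  by (simp add: L2_def)

lemma L2_norm_squared: "(L2_norm M F)\<^sup>2 = (\<integral>x. (cmod (F x))\<^sup>2 \<partial>M)"
  by (simp add: L2_norm_def)

lemma L2_add:
  assumes "F \<in> L2 M" "G \<in> L2 M"
  shows "(\<lambda>x. F x + G x) \<in> L2 M"
proof -
  have [measurable]: "F \<in> borel_measurable M" "G \<in> borel_measurable M"
    using assms by (auto simp: L2_def)
  have "integrable M (\<lambda>x. (cmod (F x + G x))\<^sup>2)"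
    by (rule Bochner_Integration.integrable_bound
        [where f = "\<lambda>x. 2 * (cmod (F x))\<^sup>2 + 2 * (cmod (G x))\<^sup>2"])
      (use assms in \<open>auto simp: L2_def cmod_add_squared_le\<close>)
  then show ?thesis by (simp add: L2_def)
qed

lemma L2_uminus: "F \<in> L2 M \<Longrightarrow> (\<lambda>x. - F x) \<in> L2 M"
  by (simp add: L2_def)

lemma L2_diff:
  assumes "F \<in> L2 M" "G \<in> L2 M"
  shows "(\<lambda>x. F x - G x) \<in> L2 M"
  using L2_add[OF assms(1) L2_uminus[OF assms(2)]] by simp

text \<open>Integrating the pointwise bound gives a substitute for the triangle inequality. The
  factor 2 does no harm where a norm only has to be made arbitrarily small.\<close>

lemma L2_norm_squared_add_le:
  assumes "F \<in> L2 M" "G \<in> L2 M"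
  shows "(L2_norm M (\<lambda>x. F x + G x))\<^sup>2 \<le> 2 * (L2_norm M F)\<^sup>2 + 2 * (L2_norm M G)\<^sup>2"
proof -
  have "(\<integral>x. (cmod (F x + G x))\<^sup>2 \<partial>M) \<le> (\<integral>x. 2 * (cmod (F x))\<^sup>2 + 2 * (cmod (G x))\<^sup>2 \<partial>M)"
    using L2_integrable[OF assms(1)] L2_integrable[OF assms(2)] L2_integrable[OF L2_add[OF assms]]
    by (intro integral_mono) (auto simp: cmod_add_squared_le)
  also have "\<dots> = 2 * (\<integral>x. (cmod (F x))\<^sup>2 \<partial>M) + 2 * (\<integral>x. (cmod (G x))\<^sup>2 \<partial>M)"
    using L2_integrable[OF assms(1)] L2_integrable[OF assms(2)] by simp
  finally show ?thesis by (simp add: L2_norm_squared)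
qed

lemma L2_norm_eq_0_iff:
  assumes "F \<in> L2 M"
  shows "L2_norm M F = 0 \<longleftrightarrow> (AE x in M. F x = 0)"
  using integral_nonneg_eq_0_iff_AE[OF L2_integrable[OF assms]] by (simp add: L2_norm_def)

lemma L2_compose:
  assumes "F \<in> L2 M" and "T \<in> M \<rightarrow>\<^sub>M M" and "distr M M T = M"
  shows "(\<lambda>x. F (T x)) \<in> L2 M"
proof -
  have "integrable (distr M M T) (\<lambda>x. (cmod (F x))\<^sup>2)"
    using assms by (simp add: L2_def)
  then have "integrable M (\<lambda>x. (cmod (F (T x)))\<^sup>2)"
    by (rule integrable_distr[OF assms(2)])
  then show ?thesis
    using assms by (auto simp: L2_def)
qed

lemma L2_norm_compose:
  assumes "F \<in> L2 M" and "T \<in> M \<rightarrow>\<^sub>M M" and "distr M M T = M"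
  shows "L2_norm M (\<lambda>x. F (T x)) = L2_norm M F"
proof -
  have "(\<integral>x. (cmod (F x))\<^sup>2 \<partial>distr M M T) = (\<integral>x. (cmod (F (T x)))\<^sup>2 \<partial>M)"
    using assms(1) by (intro integral_distr assms(2)) (auto simp: L2_def)
  then show ?thesis
    using assms(3) by (simp add: L2_norm_def)
qed

text \<open>A countable basis leaves only countably many exceptional null sets, and outside their
  union distinct values would be separated by a basic open set. This carries invariance from the
  preimages under a function to the function itself.\<close>

lemma AE_eq_if_AE_preimages:
  fixes f g :: "'a \<Rightarrow> 'b::{second_countable_topology, t2_space}"
  assumes "\<And>B. open B \<Longrightarrow> AE x in M. f x \<in> B \<longleftrightarrow> g x \<in> B"
  shows "AE x in M. f x = g x"
proof -
  obtain \<B> :: "'b set set" where \<B>: "countable \<B>" "topological_basis \<B>"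
    using ex_countable_basis by blast
  then have "AE x in M. \<forall>B\<in>\<B>. f x \<in> B \<longleftrightarrow> g x \<in> B"
    by (subst AE_ball_countable) (auto intro: assms topological_basis_open)
  then show ?thesis
  proof eventually_elim
    case (elim x)
    show ?case
    proof (rule ccontr)
      assume "f x \<noteq> g x"
      then obtain U where "open U" "f x \<in> U" "g x \<notin> U"
        using separation_t1 by blast
      then show False
        using elim \<B>(2) by (metis topological_basisE subsetD)
    qed
  qed
qed

text \<open>Primes serve as names for transformations: the sum runs over the fibre of
  \<open>q\<close>, all primes inducing the same map on the space, so the primes of a fibre are
  heavy together or not at all.\<close>

definition heavy :: "'a measure \<Rightarrow> (nat \<Rightarrow> 'a \<Rightarrow> 'a) \<Rightarrow> nat set" where
  "heavy M S = {q. prime q \<and>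
     (\<Sum>\<^sub>\<infinity>p\<in>{p. prime p \<and> restrict (S p) (space M) = restrict (S q) (space M)}.
        ennreal (1 / real p)) = \<infinity>}"

section \<open>Membership in \<open>H1\<close> as almost everywhere invariance\<close>

context multiplicative_system
begin

lemma heavy_ge_1: "q \<in> heavy M S \<Longrightarrow> q \<ge> 1"
  by (auto simp: heavy_def dest: prime_ge_1_nat)

lemma L2_difference: "F \<in> L2 M \<Longrightarrow> n \<ge> 1 \<Longrightarrow> (\<lambda>x. F (S n x) - F x) \<in> L2 M"
  by (rule L2_diff[OF L2_compose[OF _ measurable measure_preserving]])

text \<open>The squared norm \<open>d\<close> is constant on a fibre, which therefore contributes
  this finite constant times its sum of reciprocals. Such a product is infinite only if the sum
  diverges and the constant is nonzero.\<close>

lemma H1_iff: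
  assumes "finitely_generated M S"
  shows "F \<in> H1 M S \<longleftrightarrow> F \<in> L2 M \<and> (\<forall>q\<in>heavy M S. AE x in M. F (S q x) = F x)"
proof (cases "F \<in> L2 M")
  case F: True
  define d where "d p = (L2_norm M (\<lambda>x. F (S p x) - F x))\<^sup>2" for p
  define C where "C R = {p. prime p \<and> restrict (S p) (space M) = R}" for R
  let ?r = "\<lambda>p. restrict (S p) (space M)"
  let ?f = "\<lambda>p. ennreal (d p / real p)"
  have d_cong: "d p = d q" if "?r p = ?r q" for p q
  proof -
    have "S p x = S q x" if "x \<in> space M" for x
      using fun_cong[OF \<open>?r p = ?r q\<close>, of x] that by simp
    then show ?thesis
      unfolding d_def L2_norm_squared by (intro Bochner_Integration.integral_cong) auto
  qed
  have fiber: "infsum ?f (C (?r q)) = ennreal (d q) * (\<Sum>\<^sub>\<infinity>p\<in>C (?r q). ennreal (1 / real p))" for q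
  proof -
    have "infsum ?f (C (?r q)) = (\<Sum>\<^sub>\<infinity>p\<in>C (?r q). ennreal (d q) * ennreal (1 / real p))"
    proof (rule infsum_cong)
      fix p assume "p \<in> C (?r q)"
      then have "d p = d q"
        by (intro d_cong) (simp add: C_def)
      then show "?f p = ennreal (d q) * ennreal (1 / real p)"
        by (simp flip: ennreal_mult add: d_def)
    qed
    then show ?thesis by (simp add: infsum_cmult_ennreal)
  qed
  have zero: "d q = 0 \<longleftrightarrow> (AE x in M. F (S q x) = F x)" if "q \<ge> 1" for q
    using L2_norm_eq_0_iff[OF L2_difference[OF F that]] by (simp add: d_def)
  \<comment> \<open>The factor in front of the sum is neither zero nor infinite, so it does not
    affect finiteness.\<close>
  have half: "(1 / 2 :: ennreal) \<noteq> 0" "(1 / 2 :: ennreal) < \<infinity>"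
    by (auto simp: ennreal_divide_eq_0_iff ennreal_divide_eq_top_iff less_top[symmetric])
  have "F \<in> H1 M S \<longleftrightarrow> infsum ?f {p. prime p} < \<infinity>"
    using F half by (auto simp: H1_def d_def ennreal_mult_less_top)
  also have "\<dots> \<longleftrightarrow> (\<forall>q\<in>heavy M S. d q = 0)"
  proof (intro iffI ballI)
    fix q assume fin: "infsum ?f {p. prime p} < \<infinity>" and q: "q \<in> heavy M S"
    have "infsum ?f (C (?r q)) \<le> infsum ?f {p. prime p}"
      by (rule infsum_mono_neutral) (auto simp: C_def intro: nonneg_summable_on_complete)
    \<comment> \<open>The fibre of a heavy prime has reciprocal sum \<open>\<infinity>\<close>, and
      a multiple of \<open>\<infinity>\<close> is finite only when the factor is 0.\<close>
    then have "ennreal (d q) * \<infinity> < \<infinity>"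
      using fin q fiber[of q] by (auto simp: heavy_def C_def)
    then show "d q = 0"
      by (auto simp: ennreal_mult_less_top d_def)
  next
    assume h: "\<forall>q\<in>heavy M S. d q = 0"
    \<comment> \<open>Finite generation enters here: the primes are a finite union of fibres, so
      each fibre can be bounded separately.\<close>
    have "infsum ?f (\<Union>R\<in>{?r p | p. prime p}. C R) < \<infinity>"
    proof (rule infsum_UN_finite_ennreal)
      show "finite {?r p | p. prime p}"
        using assms by (simp add: finitely_generated_def)
    next
      fix R assume "R \<in> {?r p | p. prime p}"
      then obtain q where q: "prime q" "R = ?r q" by auto
      show "infsum ?f (C R) < \<infinity>"
      proof (cases "q \<in> heavy M S")
        case True
        \<comment> \<open>The contribution is \<open>0 * \<infinity>\<close>, which is 0 in
          \<open>ennreal\<close>.\<close>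
        then show ?thesis using h q fiber[of q] by simp
      next
        case False
        then have "(\<Sum>\<^sub>\<infinity>p\<in>C (?r q). ennreal (1 / real p)) \<noteq> top"
          using q(1) by (simp add: heavy_def C_def)
        then have "ennreal (d q) * (\<Sum>\<^sub>\<infinity>p\<in>C (?r q). ennreal (1 / real p)) \<noteq> top"
          by (metis ennreal_mult_eq_top_iff ennreal_neq_top)
        then show ?thesis
          unfolding q(2) fiber infinity_ennreal_def by (rule less_top[THEN iffD1])
      qed
    qed
    also have "(\<Union>R\<in>{?r p | p. prime p}. C R) = {p. prime p}"
      by (auto simp: C_def)
    finally show "infsum ?f {p. prime p} < \<infinity>" .
  qed
  also have "\<dots> \<longleftrightarrow> (\<forall>q\<in>heavy M S. AE x in M. F (S q x) = F x)"
    using zero heavy_ge_1 by blast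
  finally show ?thesis using F by simp
qed (simp add: H1_def)

section \<open>The invariant sets and their \<sigma>-algebra\<close>

lemma I_pr_iff:
  assumes "finitely_generated M S"
  shows "A \<in> I_pr M S \<longleftrightarrow> A \<in> sets M \<and> (\<forall>q\<in>heavy M S. AE x in M. S q x \<in> A \<longleftrightarrow> x \<in> A)"
proof (cases "A \<in> sets M")
  case True
  have "(indicator A :: 'a \<Rightarrow> complex) \<in> borel_measurable M"
    using True by simp
  \<comment> \<open>A bounded function is square-integrable because the measure is finite.\<close>
  moreover have "integrable M (\<lambda>x. (cmod (indicator A x))\<^sup>2)"
    using True by (intro integrable_const_bound[where B = 1]) (auto simp: indicator_def)
  ultimately have "(indicator A :: 'a \<Rightarrow> complex) \<in> L2 M"
    by (simp add: L2_def)
  moreover have "(indicator A x :: complex) = indicator A y \<longleftrightarrow> (x \<in> A \<longleftrightarrow> y \<in> A)" for x y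
    by (simp add: indicator_def)
  ultimately show ?thesis
    using True by (simp add: I_pr_def H1_iff[OF assms])
qed (simp add: I_pr_def)

text \<open>Each heavy \<open>q\<close> is treated separately, with its own null set. Complements
  stay invariant because \<open>S q\<close> maps the space into itself, countable unions because
  countably many null sets have a null union.\<close>

lemma sigma_algebra_I_pr:
  assumes "finitely_generated M S"
  shows "sigma_algebra (space M) (I_pr M S)"
  unfolding sigma_algebra_iff2
proof (intro conjI ballI allI impI)
  show "I_pr M S \<subseteq> Pow (space M)"
    using sets.sets_into_space by (auto simp: I_pr_def)
  show "{} \<in> I_pr M S"
    by (simp add: I_pr_iff[OF assms])
next
  fix A assume A: "A \<in> I_pr M S"
  have "AE x in M. S q x \<in> space M - A \<longleftrightarrow> x \<in> space M - A" if q: "q \<in> heavy M S" for q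
  proof -
    have "AE x in M. S q x \<in> A \<longleftrightarrow> x \<in> A"
      using A q by (simp add: I_pr_iff[OF assms])
    then show ?thesis
      using AE_space
    proof eventually_elim
      case (elim x)
      then show ?case
        using measurable_space[OF measurable[OF heavy_ge_1[OF q]]] by simp
    qed
  qed
  then show "space M - A \<in> I_pr M S"
    using A by (auto simp: I_pr_iff[OF assms])
next
  fix A :: "nat \<Rightarrow> 'a set" assume A: "range A \<subseteq> I_pr M S"
  have "AE x in M. S q x \<in> (\<Union>i. A i) \<longleftrightarrow> x \<in> (\<Union>i. A i)" if q: "q \<in> heavy M S" for q
  proof -
    have "AE x in M. \<forall>i. S q x \<in> A i \<longleftrightarrow> x \<in> A i"
      unfolding AE_all_countable
    proof
      fix i
      have "A i \<in> I_pr M S" using A by blast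
      then show "AE x in M. S q x \<in> A i \<longleftrightarrow> x \<in> A i"
        using q by (simp add: I_pr_iff[OF assms])
    qed
    then show ?thesis by eventually_elim simp
  qed
  moreover have "(\<Union>i. A i) \<in> sets M"
    using A by (intro sets.countable_UN) (auto simp: I_pr_def)
  ultimately show "(\<Union>i. A i) \<in> I_pr M S"
    by (simp add: I_pr_iff[OF assms])
qed

text \<open>The second claim lets measurability and integrability pass between \<open>M\<close> and
  its restriction to the invariant sets.\<close>

lemma
  assumes "finitely_generated M S"
  shows sets_sigma_I_pr: "sets (sigma (space M) (I_pr M S)) = I_pr M S"
    and subalgebra_sigma_I_pr: "subalgebra M (sigma (space M) (I_pr M S))"
proof -
  interpret I: sigma_algebra "space M" "I_pr M S"
    by (rule sigma_algebra_I_pr[OF assms])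
  show *: "sets (sigma (space M) (I_pr M S)) = I_pr M S"
    by (simp add: I.sigma_sets_eq I.space_closed)
  show "subalgebra M (sigma (space M) (I_pr M S))"
    unfolding subalgebra_def * by (simp add: I.space_closed space_measure_of) (auto simp: I_pr_def)
qed

section \<open>Invariant functions as functions measurable with respect to the invariant
  sets\<close>

lemma H1_subset_L2_subalg:
  assumes "finitely_generated M S"
  shows "H1 M S \<subseteq> L2_subalg M (sigma (space M) (I_pr M S))"
proof
  let ?N = "sigma (space M) (I_pr M S)"
  note sub = subalgebra_sigma_I_pr[OF assms]
  fix F assume "F \<in> H1 M S"
  then have F: "F \<in> L2 M" "\<And>q. q \<in> heavy M S \<Longrightarrow> AE x in M. F (S q x) = F x"
    by (auto simp: H1_iff[OF assms])
  \<comment> \<open>\<open>I_pr M S\<close> contains every measurable set that is invariant up to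
    null sets, so \<open>F\<close> is measurable as it stands and serves as its own
    representative.\<close>
  have F_meas: "F \<in> borel_measurable ?N"
  proof (rule measurableI)
    fix B :: "complex set" assume B: "B \<in> sets borel"
    have "AE x in M. S q x \<in> F -` B \<inter> space M \<longleftrightarrow> x \<in> F -` B \<inter> space M"
      if q: "q \<in> heavy M S" for q
      using F(2)[OF q] AE_space
    proof eventually_elim
      case (elim x)
      then show ?case
        using measurable_space[OF measurable[OF heavy_ge_1[OF q]]] by simp
    qed
    then have "F -` B \<inter> space M \<in> I_pr M S"
      using measurable_sets[OF L2_measurable[OF F(1)] B] by (simp add: I_pr_iff[OF assms])
    then show "F -` B \<inter> space ?N \<in> sets ?N"
      using sub unfolding sets_sigma_I_pr[OF assms] subalgebra_def by simp
  qed simp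
  have "integrable (restr_to_subalg M ?N) (\<lambda>x. (cmod (F x))\<^sup>2)"
    using F_meas by (intro integrable_in_subalg[OF sub] L2_integrable[OF F(1)]) auto
  then have "F \<in> L2 (restr_to_subalg M ?N)"
    using measurable_in_subalg[OF sub F_meas] by (simp add: L2_def)
  then show "F \<in> L2_subalg M ?N"
    using F(1) by (auto simp: L2_subalg_def)
qed

lemma L2_subalg_subset_H1:
  assumes "finitely_generated M S"
  shows "L2_subalg M (sigma (space M) (I_pr M S)) \<subseteq> H1 M S"
proof
  let ?N = "sigma (space M) (I_pr M S)"
  note sub = subalgebra_sigma_I_pr[OF assms]
  fix F assume "F \<in> L2_subalg M ?N"
  then obtain G where F: "F \<in> L2 M" and G: "G \<in> L2 (restr_to_subalg M ?N)"
    and FG: "AE x in M. F x = G x"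
    by (auto simp: L2_subalg_def)
  have G_meas: "G \<in> borel_measurable ?N"
    using measurable_in_subalg'[OF sub L2_measurable[OF G]] .
  have "AE x in M. F (S q x) = F x" if q: "q \<in> heavy M S" for q
  proof -
    note Sq = measurable[OF heavy_ge_1[OF q]]
    \<comment> \<open>Invariance is shown first for the representative \<open>G\<close>, whose
      preimages of open sets are exactly members of \<open>I_pr M S\<close>.\<close>
    have "AE x in M. G (S q x) = G x"
    proof (rule AE_eq_if_AE_preimages)
      fix B :: "complex set" assume "open B"
      then have "G -` B \<inter> space ?N \<in> sets ?N"
        using measurable_sets[OF G_meas] by simp
      then have "G -` B \<inter> space M \<in> I_pr M S"
        using sub unfolding sets_sigma_I_pr[OF assms] subalgebra_def by simp
      then have "AE x in M. S q x \<in> G -` B \<inter> space M \<longleftrightarrow> x \<in> G -` B \<inter> space M"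
        using q by (simp add: I_pr_iff[OF assms])
      then show "AE x in M. G (S q x) \<in> B \<longleftrightarrow> G x \<in> B"
        using AE_space
      proof eventually_elim
        case (elim x)
        then show ?case
          using measurable_space[OF Sq] by simp
      qed
    qed
    \<comment> \<open>To return to \<open>F\<close>, equality with \<open>G\<close> is needed at
      \<open>S q x\<close> as well: \<open>S q\<close> preserves the measure, so it pulls the
      exceptional null set back to a null set.\<close>
    moreover have "AE x in distr M M (S q). F x = G x"
      unfolding measure_preserving[OF heavy_ge_1[OF q]] by (rule FG)
    then have "AE x in M. F (S q x) = G (S q x)"
      by (rule AE_distrD[OF Sq])
    ultimately show ?thesis
      using FG by eventually_elim simp
  qed
  then show "F \<in> H1 M S"
    using F by (simp add: H1_iff[OF assms])
qed

section \<open>Closedness of \<open>H1\<close> in \<open>L2\<close>\<close>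

lemma L2_closure_H1:
  assumes "finitely_generated M S"
  shows "L2_closure M (H1 M S) = H1 M S"
proof
  show "H1 M S \<subseteq> L2_closure M (H1 M S)"
  proof
    fix F assume F: "F \<in> H1 M S"
    moreover have "L2_norm M (\<lambda>x. F x - F x) = 0"
      by (simp add: L2_norm_def)
    ultimately show "F \<in> L2_closure M (H1 M S)"
      by (auto simp: L2_closure_def H1_def intro!: bexI[of _ F])
  qed
  show "L2_closure M (H1 M S) \<subseteq> H1 M S"
  proof
    fix F assume "F \<in> L2_closure M (H1 M S)"
    then have F: "F \<in> L2 M"
      and approx: "\<And>\<epsilon>. \<epsilon> > 0 \<Longrightarrow> \<exists>G\<in>H1 M S. L2_norm M (\<lambda>x. F x - G x) < \<epsilon>"
      by (auto simp: L2_closure_def)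
    have "AE x in M. F (S q x) = F x" if q: "q \<in> heavy M S" for q
    proof -
      note q1 = heavy_ge_1[OF q]
      let ?D = "L2_norm M (\<lambda>x. F (S q x) - F x)"
      \<comment> \<open>An approximant \<open>G\<close> from \<open>H1\<close> is invariant and
        cancels, so \<open>F\<close> and the error \<open>E = F - G\<close> have the same difference
        along \<open>S q\<close>. Both terms of that difference have the norm of \<open>E\<close>,
        below \<open>\<epsilon>\<close>; the constant is 4 = 2 + 2.\<close>
      have bound: "?D\<^sup>2 \<le> 4 * \<epsilon>\<^sup>2" if pos: "\<epsilon> > 0" for \<epsilon>
      proof -
        obtain G where G: "G \<in> H1 M S" and less: "L2_norm M (\<lambda>x. F x - G x) < \<epsilon>"
          using approx[OF pos] by blast
        define E where "E x = F x - G x" for x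
        have G2: "G \<in> L2 M" "AE x in M. G (S q x) = G x"
          using G q by (auto simp: H1_iff[OF assms])
        have E: "E \<in> L2 M"
          unfolding E_def by (rule L2_diff[OF F G2(1)])
        have "?D\<^sup>2 = (L2_norm M (\<lambda>x. E (S q x) + - E x))\<^sup>2"
          unfolding L2_norm_squared
        proof (rule integral_cong_AE)
          show "(\<lambda>x. (cmod (F (S q x) - F x))\<^sup>2) \<in> borel_measurable M"
            using L2_integrable[OF L2_difference[OF F q1]] by simp
          show "(\<lambda>x. (cmod (E (S q x) + - E x))\<^sup>2) \<in> borel_measurable M"
            using L2_integrable[OF L2_difference[OF E q1]] by simp
          show "AE x in M. (cmod (F (S q x) - F x))\<^sup>2 = (cmod (E (S q x) + - E x))\<^sup>2"
            using G2(2) by eventually_elim (simp add: E_def)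
        qed
        also have "\<dots> \<le> 2 * (L2_norm M (\<lambda>x. E (S q x)))\<^sup>2 + 2 * (L2_norm M (\<lambda>x. - E x))\<^sup>2"
          by (rule L2_norm_squared_add_le[OF
              L2_compose[OF E measurable[OF q1] measure_preserving[OF q1]] L2_uminus[OF E]])
        also have "L2_norm M (\<lambda>x. E (S q x)) = L2_norm M E"
          by (rule L2_norm_compose[OF E measurable[OF q1] measure_preserving[OF q1]])
        also have "L2_norm M (\<lambda>x. - E x) = L2_norm M E"
          by (simp add: L2_norm_def)
        finally have "?D\<^sup>2 \<le> 4 * (L2_norm M E)\<^sup>2" by simp
        also have "(L2_norm M E)\<^sup>2 \<le> \<epsilon>\<^sup>2"
          using less by (intro power_mono) (auto simp: E_def[abs_def] L2_norm_def)
        finally show ?thesis by simp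
      qed
      have "?D = 0"
      proof (rule ccontr)
        assume "?D \<noteq> 0"
        then have "?D > 0" by (simp add: L2_norm_def order.not_eq_order_implies_strict)
        \<comment> \<open>With \<open>\<epsilon> = ?D / 4\<close> the bound reads
          \<open>?D\<^sup>2 \<le> ?D\<^sup>2 / 4\<close>, impossible for positive
          \<open>?D\<close>.\<close>
        then show False
          using bound[of "?D / 4"] by (simp add: power_divide)
      qed
      then show ?thesis
        using L2_norm_eq_0_iff[OF L2_difference[OF F q1]] by simp
    qed
    then show "F \<in> H1 M S"
      using F by (simp add: H1_iff[OF assms])
  qed
qed

end

theorem proposition1p10:
  fixes M :: "'a::metric_space measure" and S :: "nat \<Rightarrow> 'a \<Rightarrow> 'a"
  assumes "multiplicative_system M S"
    and "finitely_generated M S"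
  shows "L2_closure M (H1 M S) = L2_subalg M (sigma (space M) (I_pr M S))"
proof -
  interpret multiplicative_system M S by fact
  show ?thesis
    using L2_closure_H1 H1_subset_L2_subalg L2_subalg_subset_H1 assms(2) by blast
qed

end
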